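(* Let $\xi_1,\dots,\xi_k$ be mutually independent standard normal random variables, let $n\ge 0$ be an integer, and let $$S(\xi)=\sum_{|I|=0}^n a_I\,\xi^I=\sum_{|I|=0}^n a_I\,\xi_1^{i_1}\cdots\xi_k^{i_k}$$ be a finite linear combination, with real coefficients $a_I$, of products of these random variables, the sum being over all multiindices $I$ with $0\le |I|\le n$. If $S(\xi)=0$ as a random variable (i.e. almost surely), then $a_I=0$ for all multiindices $I$ in the sum.
   Context: A multiindex is a tuple $I=(i_1,\dots,i_k)$ of nonnegative integers; $|I|=i_1+\cdots+i_k$ and $\xi^I=\xi_1^{i_1}\cdots\xi_k^{i_k}$. *)

theory Defs
  imports "HOL-Probability.Probability"
begin

definition mi_order :: "nat \<Rightarrow> (nat \<Rightarrow> nat) \<Rightarrow> nat" where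
  "mi_order k I = (\<Sum>j=1..k. I j)"

text \<open>A \<open>k\<close>-tuple is a function on \<open>{1..k}\<close>; extensionality (\<open>undefined\<close> outside
  \<open>{1..k}\<close>) makes every tuple represented by exactly one function.\<close>

definition multiindices :: "nat \<Rightarrow> nat \<Rightarrow> (nat \<Rightarrow> nat) set" where
  "multiindices k n = {I \<in> {1..k} \<rightarrow>\<^sub>E UNIV. mi_order k I \<le> n}"

definition mi_power :: "nat \<Rightarrow> (nat \<Rightarrow> real) \<Rightarrow> (nat \<Rightarrow> nat) \<Rightarrow> real" where
  "mi_power k x I = (\<Prod>j=1..k. x j ^ I j)"

text \<open>Finiteness matters because \<open>sum\<close> over an infinite set would be \<open>0\<close>.\<close>

lemma finite_multiindices: "finite (multiindices k n)"
proof (rule finite_subset)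
  show "multiindices k n \<subseteq> {1..k} \<rightarrow>\<^sub>E {..n}"
  proof
    fix I assume "I \<in> multiindices k n"
    then have ext: "I \<in> {1..k} \<rightarrow>\<^sub>E UNIV" and le: "(\<Sum>j=1..k. I j) \<le> n"
      by (auto simp: multiindices_def mi_order_def)
    have "I j \<le> n" if "j \<in> {1..k}" for j
      using member_le_sum[OF that, of I] le by auto
    then show "I \<in> {1..k} \<rightarrow>\<^sub>E {..n}"
      using ext by (auto simp: PiE_iff)
  qed
  show "finite ({1..k} \<rightarrow>\<^sub>E {..n})"
    by (intro finite_PiE) auto
qed

end

theory Submission
  imports Defs
begin

text \<open>By independence, the polynomial vanishes almost everywhere for the product of the laws of the
  variables. By Fubini, for almost every value of the first variable the resulting polynomial in
  the others vanishes almost everywhere, so by induction its coefficients are \<open>0\<close>. These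
  coefficients are themselves polynomials in the first variable; since its law has no atoms, a
  nonzero polynomial, having finitely many roots, cannot vanish almost everywhere.\<close>

text \<open>The index type is arbitrary so that the lemma applies directly to a set of multiindices,
  with \<open>e\<close> reading off one entry. Injectivity of \<open>e\<close> keeps two
  coefficients from merging into one monomial.\<close>

lemma coeffs_eq_0_if_AE_poly_eq_0:
  fixes N :: "real measure" and a :: "'b \<Rightarrow> real" and e :: "'b \<Rightarrow> nat"
  assumes "prob_space N" and sets_N: "sets N = sets borel"
    and no_atoms: "\<And>x. emeasure N {x} = 0"
    and fin: "finite A" and inj: "inj_on e A"
    and AE0: "AE x in N. (\<Sum>I\<in>A. a I * x ^ e I) = 0"
    and I: "I \<in> A"
  shows "a I = 0"
proof -
  interpret prob_space N by fact
  define p where "p = (\<Sum>I\<in>A. monom (a I) (e I))"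
  have poly_p: "poly p x = (\<Sum>I\<in>A. a I * x ^ e I)" for x
    by (simp add: p_def poly_sum poly_monom)
  have "p = 0"
  proof (rule ccontr)
    assume "p \<noteq> 0"
    then have "countable {x. poly p x = 0}"
      using poly_roots_finite countable_finite by blast
    then have "AE x in N. \<forall>y\<in>{y. poly p y = 0}. x \<noteq> y"
    proof (subst AE_ball_countable, assumption, intro ballI)
      fix y :: real
      show "AE x in N. x \<noteq> y"
        by (rule AE_I[of _ _ "{y}"]) (auto simp: no_atoms sets_N)
    qed
    then have "AE x in N. False"
      using AE0 by eventually_elim (auto simp: poly_p)
    \<comment> \<open>The whole space has measure 1, so it is not null.\<close>
    then show False by simp
  qed
  then have "0 = coeff p (e I)" by simp
  also have "\<dots> = (\<Sum>J\<in>A. if J = I then a J else 0)"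
    unfolding p_def coeff_sum coeff_monom using inj I
    by (intro sum.cong) (auto simp: inj_on_def)
  finally show ?thesis using fin I by simp
qed

text \<open>Allowing any finite set \<open>A\<close> of exponents gives a form stable under the
  induction, which replaces \<open>A\<close> by its restrictions to fewer variables.\<close>

lemma coeffs_eq_0_if_AE_PiM_eq_0:
  fixes N :: "'i \<Rightarrow> real measure" and a :: "('i \<Rightarrow> nat) \<Rightarrow> real"
  assumes prob: "\<And>i. prob_space (N i)" and sets_N: "\<And>i. sets (N i) = sets borel"
    and no_atoms: "\<And>i x. emeasure (N i) {x} = 0"
    and "finite J" and "finite A" and "A \<subseteq> J \<rightarrow>\<^sub>E UNIV"
    and "AE x in PiM J N. (\<Sum>I\<in>A. a I * (\<Prod>j\<in>J. x j ^ I j)) = 0"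
    and "I \<in> A"
  shows "a I = 0"
  using assms(4-)
proof (induction J arbitrary: A a I)
  case empty
  interpret prob_space "PiM {} N" by (intro prob_space_PiM prob)
  \<comment> \<open>Only one extensional function lives on the empty set, so the sum is the constant
    \<open>a I\<close>.\<close>
  have "A = {I}" using empty.prems by auto
  then show ?case using empty.prems by simp
next
  case (insert i J)
  interpret J: prob_space "PiM J N" by (intro prob_space_PiM prob)
  interpret P: pair_sigma_finite "N i" "PiM J N"
    by (simp add: pair_sigma_finite_def prob prob_space_imp_sigma_finite J.sigma_finite_measure_axioms)
  note [measurable_cong] = sets_N
  \<comment> \<open>The sum is to be read as a polynomial in the variables of \<open>J\<close>:
    \<open>B\<close> collects its exponents, and \<open>b x I'\<close> is the coefficient of the
    monomial \<open>I'\<close> once variable \<open>i\<close> has the value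
    \<open>x\<close>.\<close>
  define B where "B = (\<lambda>I. restrict I J) ` A"
  define b where "b x I' = (\<Sum>I\<in>{I\<in>A. restrict I J = I'}. a I * x ^ I i)" for x I'
  \<comment> \<open>The product over \<open>insert i J\<close> is the image of a binary product, to
    which Fubini applies.\<close>
  have "AE X in distr (N i \<Otimes>\<^sub>M PiM J N) (PiM (insert i J) N) (\<lambda>(x, X). X(i := x)).
      (\<Sum>I\<in>A. a I * (\<Prod>j\<in>insert i J. X j ^ I j)) = 0"
    unfolding distr_pair_PiM_eq_PiM[where M = N, OF prob prob] by (rule insert.prems(3))
  then have "AE z in N i \<Otimes>\<^sub>M PiM J N.
      (\<Sum>I\<in>A. a I * (\<Prod>j\<in>insert i J. ((\<lambda>(x, X). X(i := x)) z) j ^ I j)) = 0"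
    by (rule AE_distrD[rotated]) measurable
  then have "AE x in N i. AE X in PiM J N.
      (\<Sum>I\<in>A. a I * (\<Prod>j\<in>insert i J. (X(i := x)) j ^ I j)) = 0"
    by (rule P.AE_pair[THEN eventually_mono]) simp
  moreover have "(\<Sum>I\<in>A. a I * (\<Prod>j\<in>insert i J. (X(i := x)) j ^ I j))
      = (\<Sum>I'\<in>B. b x I' * (\<Prod>j\<in>J. X j ^ I' j))" for x X
  proof -
    have "(\<Prod>j\<in>J. (X(i := x)) j ^ I j) = (\<Prod>j\<in>J. X j ^ restrict I J j)" for I
      using insert.hyps by (intro prod.cong) auto
    then have eq: "a I * (\<Prod>j\<in>insert i J. (X(i := x)) j ^ I j)
        = a I * x ^ I i * (\<Prod>j\<in>J. X j ^ restrict I J j)" for I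
      using insert.hyps by (simp add: mult.assoc)
    show ?thesis
      unfolding B_def b_def sum_distrib_right
      by (subst sum.image_gen[OF insert.prems(1), where g = "\<lambda>I. restrict I J"])
         (intro sum.cong refl, auto simp only: eq)
  qed
  ultimately have "AE x in N i. AE X in PiM J N. (\<Sum>I'\<in>B. b x I' * (\<Prod>j\<in>J. X j ^ I' j)) = 0"
    by (simp only:)
  \<comment> \<open>For each such \<open>x\<close> the induction hypothesis is used with the
    coefficients \<open>b x\<close>, which is why \<open>a\<close> and \<open>A\<close> are
    generalized.\<close>
  then have "AE x in N i. \<forall>I'\<in>B. b x I' = 0"
  proof eventually_elim
    case (elim x)
    have "finite B" "B \<subseteq> J \<rightarrow>\<^sub>E UNIV" using insert.prems(1) by (auto simp: B_def)
    with elim show ?case using insert.IH by blast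
  qed
  then have "AE x in N i. b x (restrict I J) = 0"
    by eventually_elim (use insert.prems(4) in \<open>auto simp: B_def\<close>)
  \<comment> \<open>Within one fibre of the restriction to \<open>J\<close>, only the entry at
    \<open>i\<close> can vary.\<close>
  moreover have "inj_on (\<lambda>I. I i) {L \<in> A. restrict L J = restrict I J}"
  proof (rule inj_onI)
    fix K L assume KL: "K \<in> {L \<in> A. restrict L J = restrict I J}"
      "L \<in> {L \<in> A. restrict L J = restrict I J}" "K i = L i"
    then have "restrict K J = restrict L J" by simp
    then have "K j = L j" if "j \<in> J" for j using that by (metis restrict_apply')
    then show "K = L" using KL insert.prems(2) by (intro PiE_ext[of K "insert i J" _ L]) auto
  qed
  ultimately show ?case
    using insert.prems(1,4) unfolding b_def
    by (intro coeffs_eq_0_if_AE_poly_eq_0[where a = a and e = "\<lambda>I. I i"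
          and A = "{L \<in> A. restrict L J = restrict I J}", OF prob sets_N no_atoms]) auto
qed

theorem theorem1:
  fixes M :: "'w measure"
    and k n :: nat
    and \<xi> :: "nat \<Rightarrow> 'w \<Rightarrow> real"
    and a :: "(nat \<Rightarrow> nat) \<Rightarrow> real"
  assumes "prob_space M"
    and "prob_space.indep_vars M (\<lambda>_. borel) \<xi> {1..k}"
    and "\<And>j. j \<in> {1..k} \<Longrightarrow> distributed M lborel (\<xi> j) std_normal_density"
    and "AE w in M. (\<Sum>I\<in>multiindices k n. a I * mi_power k (\<lambda>j. \<xi> j w) I) = 0"
  shows "\<forall>I\<in>multiindices k n. a I = 0"
proof -
  interpret prob_space M by fact
  \<comment> \<open>A family over all naturals, since the lemma on products asks for a probability
    measure at every index, while the laws are known on \<open>{1..k}\<close> only.\<close>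
  define N where "N = (\<lambda>_::nat. density lborel std_normal_density)"
  have sets_N: "sets (N j) = sets borel" for j by (simp add: N_def)
  have rv: "\<xi> j \<in> borel_measurable M" if "j \<in> {1..k}" for j
    using assms(3)[OF that] by (simp add: distributed_def)
  have distr_N: "distr M borel (\<xi> j) = N j" if "j \<in> {1..k}" for j
    using assms(3)[OF that] by (simp add: distributed_def N_def cong: distr_cong)
  note [measurable_cong] = sets_N
  have "distr M (PiM {1..k} N) (\<lambda>w. \<lambda>j\<in>{1..k}. \<xi> j w) = PiM {1..k} N"
  \<comment> \<open>The characterization of independence by the joint law needs a nonempty index
    set. For \<open>k = 0\<close> both sides are the probability measure on a one-point
    space.\<close>
  proof (cases "k = 0")
    case True
    have "(\<lambda>w. \<lambda>_. undefined) \<in> M \<rightarrow>\<^sub>M PiM {} N" by (simp add: PiM_empty)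
    with True show ?thesis
      by (intro measure_eqI)
         (auto simp: restrict_def PiM_empty emeasure_distr emeasure_space_1 subset_singleton_iff)
  next
    case False
    then have "distr M (PiM {1..k} (\<lambda>_. borel)) (\<lambda>w. \<lambda>j\<in>{1..k}. \<xi> j w)
        = PiM {1..k} (\<lambda>j. distr M borel (\<xi> j))"
      using indep_vars_iff_distr_eq_PiM'[of "{1..k}" \<xi> "\<lambda>_. borel"] rv assms(2) by auto
    also have "\<dots> = PiM {1..k} N" by (intro PiM_cong distr_N) auto
    finally show ?thesis by (simp add: sets_N cong: distr_cong sets_PiM_cong)
  qed
  moreover have "AE x in distr M (PiM {1..k} N) (\<lambda>w. \<lambda>j\<in>{1..k}. \<xi> j w).
      (\<Sum>I\<in>multiindices k n. a I * (\<Prod>j\<in>{1..k}. x j ^ I j)) = 0"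
  proof (subst AE_distr_iff)
    show "(\<lambda>w. \<lambda>j\<in>{1..k}. \<xi> j w) \<in> M \<rightarrow>\<^sub>M PiM {1..k} N"
      using rv by (intro measurable_restrict) (simp cong: measurable_cong_sets add: sets_N)
    show "{x \<in> space (PiM {1..k} N).
        (\<Sum>I\<in>multiindices k n. a I * (\<Prod>j\<in>{1..k}. x j ^ I j)) = 0} \<in> sets (PiM {1..k} N)"
      by measurable
  qed (use assms(4) in \<open>simp add: mi_power_def\<close>)
  ultimately have "AE x in PiM {1..k} N.
      (\<Sum>I\<in>multiindices k n. a I * (\<Prod>j\<in>{1..k}. x j ^ I j)) = 0"
    by (simp only:)
  moreover have "prob_space (N j)" for j
    unfolding N_def by (rule prob_space_normal_density) simp
  moreover have "emeasure (N j) {x} = 0" for j x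
    by (simp add: N_def emeasure_density)
  ultimately show ?thesis
    using sets_N finite_multiindices
    by (intro ballI coeffs_eq_0_if_AE_PiM_eq_0[of N "{1..k}" "multiindices k n" a])
       (auto simp: multiindices_def)
qed

end
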